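(* Each $h_2$-singular normal arc $\lambda_t$, $t\in I$, of the time-optimal problem on the Cartan group described in the context satisfies one of the following conditions on $I$: (a) $h_2=h_3=h_4=h_5\equiv0$, $h_1\equiv\mathrm{const}\neq0$, and $u_1\equiv s_1\in\{\pm1\}$, $|u_2(t)|\le1$; (b) $h_2=h_3\equiv0$, $h_1\equiv\mathrm{const}\ne0$, $h_5\ne0$, $\left|\frac{h_4}{h_5}\right|\le1$, and $u_1\equiv s_1\in\{\pm1\}$, $u_2\equiv u_2^a=-s_1\frac{h_4}{h_5}$.
   Context: Let $M=\mathbb R^5$ with coordinates $(x,y,z,v,w)$, and let $X_1=\partial_x-\frac y2\partial_z-\frac{x^2+y^2}{2}\partial_w$, $X_2=\partial_y+\frac x2\partial_z+\frac{x^2+y^2}{2}\partial_v$, $X_3=\partial_z+x\partial_v+y\partial_w$, $X_4=\partial_v$, $X_5=\partial_w$ (left-invariant fields on the Cartan group $M$, with identity $\mathrm{Id}=0$; nonzero brackets $[X_1,X_2]=X_3$, $[X_1,X_3]=X_4$, $[X_2,X_3]=X_5$). Time-optimal problem: $\dot q=u_1X_1(q)+u_2X_2(q)$, $u=(u_1,u_2)$ measurable with values in $U=\{u\in\mathbb R^2:\max(|u_1|,|u_2|)\le 1\}$, $q(0)=\mathrm{Id}$, $q(T)=q_1$, $T\to\min$. Equalities and inequalities for controls are understood for a.e. $t$. For $\lambda\in T^*M$ set $h_i(\lambda)=\langle\lambda,X_i\rangle$, $i=1,\dots,5$, and $H=|h_1|+|h_2|$. A normal extremal is a Lipschitz curve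 $\lambda_t\in T^*_{q(t)}M$, $t\in[0,T]$, with an admissible control $u$, satisfying $\dot h_1=-u_2h_3$, $\dot h_2=u_1h_3$, $\dot h_3=u_1h_4+u_2h_5$, $\dot h_4=\dot h_5=0$, $\dot q=u_1X_1+u_2X_2$, the maximum condition $u_1(t)h_1(\lambda_t)+u_2(t)h_2(\lambda_t)=\max_{v\in U}(v_1h_1+v_2h_2)(\lambda_t)=H(\lambda_t)$, and $H(\lambda_t)\equiv\mathrm{const}>0$. An $h_2$-singular normal arc is the restriction of a normal extremal to an open interval $I=(\alpha,\beta)\subset[0,T]$ on which $h_2(\lambda_t)\equiv0$. *)

theory Defs
  imports "HOL-Analysis.Analysis"
begin

text \<open>
  Points of the manifold are vectors \<open>q = (x, y, z, v, w)\<close> of \<^typ>\<open>real^5\<close>. The cotangent bundle is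
  trivialised by the coordinate coframe: a covector is a pair \<open>(q, p)\<close>, where \<open>p\<close> collects the
  coefficients of \<open>dx, dy, dz, dv, dw\<close>, and its pairing with a tangent vector at \<open>q\<close> is the inner
  product with \<open>p\<close>. In the index type \<open>5\<close> the numeral \<open>5\<close> denotes the same element as \<open>0\<close>, so
  \<open>1, \<dots>, 5\<close> are the five distinct indices.
\<close>

type_synonym point = "real^5"
type_synonym covector = "point \<times> (real^5)"
type_synonym vector_field = "point \<Rightarrow> real^5"

abbreviation coord_x :: "point \<Rightarrow> real" where "coord_x q \<equiv> q $ 1"
abbreviation coord_y :: "point \<Rightarrow> real" where "coord_y q \<equiv> q $ 2"

abbreviation d_x :: "real^5" where "d_x \<equiv> axis 1 1"
abbreviation d_y :: "real^5" where "d_y \<equiv> axis 2 1"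
abbreviation d_z :: "real^5" where "d_z \<equiv> axis 3 1"
abbreviation d_v :: "real^5" where "d_v \<equiv> axis 4 1"
abbreviation d_w :: "real^5" where "d_w \<equiv> axis 5 1"

definition X1 :: vector_field where
  "X1 q = d_x - (coord_y q / 2) *\<^sub>R d_z - (((coord_x q)\<^sup>2 + (coord_y q)\<^sup>2) / 2) *\<^sub>R d_w"

definition X2 :: vector_field where
  "X2 q = d_y + (coord_x q / 2) *\<^sub>R d_z + (((coord_x q)\<^sup>2 + (coord_y q)\<^sup>2) / 2) *\<^sub>R d_v"

definition X3 :: vector_field where
  "X3 q = d_z + coord_x q *\<^sub>R d_v + coord_y q *\<^sub>R d_w"

definition X4 :: vector_field where
  "X4 q = d_v"

definition X5 :: vector_field where
  "X5 q = d_w"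

definition lin_ham :: "vector_field \<Rightarrow> covector \<Rightarrow> real" where
  "lin_ham X l = snd l \<bullet> X (fst l)"

abbreviation h1 :: "covector \<Rightarrow> real" where "h1 \<equiv> lin_ham X1"
abbreviation h2 :: "covector \<Rightarrow> real" where "h2 \<equiv> lin_ham X2"
abbreviation h3 :: "covector \<Rightarrow> real" where "h3 \<equiv> lin_ham X3"
abbreviation h4 :: "covector \<Rightarrow> real" where "h4 \<equiv> lin_ham X4"
abbreviation h5 :: "covector \<Rightarrow> real" where "h5 \<equiv> lin_ham X5"

definition max_ham :: "covector \<Rightarrow> real" where
  "max_ham l = \<bar>h1 l\<bar> + \<bar>h2 l\<bar>"

definition control_set :: "(real^2) set" where
  "control_set = {u. max \<bar>u $ 1\<bar> \<bar>u $ 2\<bar> \<le> 1}"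

definition admissible_control :: "real \<Rightarrow> (real \<Rightarrow> real^2) \<Rightarrow> bool" where
  "admissible_control T u \<longleftrightarrow>
     u \<in> borel_measurable (lebesgue_on {0..T}) \<and>
     (AE t in lebesgue_on {0..T}. u t \<in> control_set)"

text \<open>
  A Lipschitz curve is only differentiable almost everywhere, so the differential equations and the
  maximum condition are imposed for almost every time. The supremum below is a maximum, since the
  control set is compact. No initial point is prescribed for the trajectory: the system is
  left-invariant.
\<close>

definition normal_extremal ::
    "real \<Rightarrow> (real \<Rightarrow> covector) \<Rightarrow> (real \<Rightarrow> real^2) \<Rightarrow> bool" where
  "normal_extremal T lam u \<longleftrightarrow>
     0 < T \<and>
     (\<exists>L. L-lipschitz_on {0..T} lam) \<and>
     admissible_control T u \<and>
     (AE t in lebesgue_on {0..T}.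
        ((\<lambda>s. h1 (lam s)) has_real_derivative - (u t $ 2) * h3 (lam t)) (at t within {0..T}) \<and>
        ((\<lambda>s. h2 (lam s)) has_real_derivative u t $ 1 * h3 (lam t)) (at t within {0..T}) \<and>
        ((\<lambda>s. h3 (lam s)) has_real_derivative u t $ 1 * h4 (lam t) + u t $ 2 * h5 (lam t))
          (at t within {0..T}) \<and>
        ((\<lambda>s. h4 (lam s)) has_real_derivative 0) (at t within {0..T}) \<and>
        ((\<lambda>s. h5 (lam s)) has_real_derivative 0) (at t within {0..T}) \<and>
        ((\<lambda>s. fst (lam s)) has_vector_derivative
           (u t $ 1) *\<^sub>R X1 (fst (lam t)) + (u t $ 2) *\<^sub>R X2 (fst (lam t))) (at t within {0..T})) \<and>
     (AE t in lebesgue_on {0..T}.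
        u t $ 1 * h1 (lam t) + u t $ 2 * h2 (lam t)
          = (SUP v\<in>control_set. v $ 1 * h1 (lam t) + v $ 2 * h2 (lam t)) \<and>
        (SUP v\<in>control_set. v $ 1 * h1 (lam t) + v $ 2 * h2 (lam t)) = max_ham (lam t)) \<and>
     (\<exists>c>0. \<forall>t\<in>{0..T}. max_ham (lam t) = c)"

definition h2_singular_normal_arc ::
    "real \<Rightarrow> (real \<Rightarrow> covector) \<Rightarrow> (real \<Rightarrow> real^2) \<Rightarrow> real \<Rightarrow> real \<Rightarrow> bool" where
  "h2_singular_normal_arc T lam u \<alpha> \<beta> \<longleftrightarrow>
     normal_extremal T lam u \<and>
     \<alpha> < \<beta> \<and> {\<alpha><..<\<beta>} \<subseteq> {0..T} \<and>
     (\<forall>t\<in>{\<alpha><..<\<beta>}. h2 (lam t) = 0)"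

end

theory Submission
  imports Defs
begin

text \<open>
  The covector components \<open>h\<^sub>4\<close> and \<open>h\<^sub>5\<close> are Lipschitz with derivative zero almost everywhere,
  hence constant. Where \<open>h\<^sub>2\<close> vanishes, \<open>\<bar>h\<^sub>1\<bar> = H\<close> is a positive constant, so \<open>h\<^sub>1\<close> is constant by
  continuity, and the maximum condition gives \<open>u\<^sub>1 = s\<^sub>1 = sgn h\<^sub>1\<close>. Differentiating \<open>h\<^sub>2 = 0\<close> gives
  \<open>h\<^sub>3 = 0\<close>, and differentiating once more gives \<open>s\<^sub>1 h\<^sub>4 + u\<^sub>2 h\<^sub>5 = 0\<close>; the two alternatives are
  \<open>h\<^sub>5 = 0\<close> and \<open>h\<^sub>5 \<noteq> 0\<close>.
\<close>

section \<open>Null sets and constancy of real functions\<close>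

text \<open>Sard's theorem in dimension one. As \<open>baby_Sard\<close> speaks of maps between
  Cartesian spaces, \<open>f\<close> is transported to \<open>real^1\<close>, where the zero
  derivative has rank 0 < 1.\<close>

lemma negligible_image_zero_deriv:
  fixes f :: "real \<Rightarrow> real"
  assumes "\<And>x. x \<in> S \<Longrightarrow> (f has_real_derivative 0) (at x within S)"
  shows "negligible (f ` S)"
proof -
  let ?S = "vec ` S :: (real^1) set"
  let ?g = "\<lambda>x::real^1. f (x $ 1) *\<^sub>R (axis 1 1 :: real^1)"
  have "negligible (?g ` ?S)"
  proof (rule baby_Sard)
    show "(?g has_derivative (\<lambda>h. 0)) (at x within ?S)" if "x \<in> ?S" for x
    proof -
      have "x $ 1 \<in> S" using that by auto
      moreover have "(\<lambda>x::real^1. x $ 1) ` ?S = S" by force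
      ultimately have "(f has_derivative (\<lambda>h. 0)) (at (x $ 1) within (\<lambda>x. x $ 1) ` ?S)"
        using assms[of "x $ 1"] by (simp add: has_field_derivative_def lambda_zero)
      from has_derivative_in_compose[OF bounded_linear_imp_has_derivative[OF bounded_linear_vec_nth] this]
      have "((\<lambda>x::real^1. f (x $ 1)) has_derivative (\<lambda>h. 0)) (at x within ?S)" .
      from has_derivative_scaleR_left[OF this, of "axis 1 1"] show ?thesis by simp
    qed
    have "matrix (\<lambda>h::real^1. 0 :: real^1) = 0"
      by (simp add: matrix_def vec_eq_iff)
    then show "rank (matrix (\<lambda>h::real^1. 0 :: real^1)) < CARD(1)"
      by (simp add: rank_eq_0)
  qed simp
  \<comment> \<open>Back to the reals: the coordinate projection is 1-Lipschitz and so preserves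
    null sets.\<close>
  then have "negligible ((\<lambda>x. x $ 1) ` (?g ` ?S))"
  proof (rule negligible_locally_Lipschitz_image[rotated], goal_cases)
    case (1 x)
    show ?case
      by (rule exI[of _ UNIV], rule exI[of _ 1])
         (simp add: component_le_norm_cart flip: vector_minus_component)
  qed simp
  moreover have "(\<lambda>x. x $ 1) ` (?g ` ?S) = f ` S"
    by (force simp: image_image)
  ultimately show ?thesis by simp
qed

text \<open>
  The image is a connected null set: the exceptional null set has null image because \<open>f\<close> is
  Lipschitz, and the critical points have null image by Sard's theorem.
\<close>

lemma lipschitz_AE_deriv_zero_constant_on:
  fixes f :: "real \<Rightarrow> real"
  assumes lip: "L-lipschitz_on {a..b} f"
    and der: "AE x in lebesgue_on {a..b}. (f has_real_derivative 0) (at x within {a..b})"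
  shows "f constant_on {a..b}"
proof -
  define S where "S = {x \<in> {a..b}. (f has_real_derivative 0) (at x within {a..b})}"
  have "AE x in lebesgue. \<not> (x \<in> {a..b} - S)"
    using der by (auto simp: AE_restrict_space_iff S_def elim!: eventually_mono)
  then have "negligible ({a..b} - S)"
    unfolding negligible_iff_null_sets by (subst completion.null_sets_iff_AE) auto
  then have "negligible (f ` ({a..b} - S))"
  proof (rule negligible_locally_Lipschitz_image[rotated], goal_cases)
    case (1 x)
    then show ?case
      using lipschitz_onD[OF lip] by (auto simp: dist_norm intro!: exI[of _ UNIV] exI[of _ L])
  qed simp
  moreover have "negligible (f ` S)"
  proof (rule negligible_image_zero_deriv)
    show "(f has_real_derivative 0) (at x within S)" if "x \<in> S" for x
      by (rule DERIV_subset[of f 0 x "{a..b}"]) (use that in \<open>auto simp: S_def\<close>)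
  qed
  ultimately have neg: "negligible (f ` {a..b})"
    using negligible_subset[OF negligible_Un, of "f ` ({a..b} - S)" "f ` S" "f ` {a..b}"] by auto
  have conn: "connected (f ` {a..b})"
    by (intro connected_continuous_image lipschitz_on_continuous_on[OF lip] connected_Icc)
  \<comment> \<open>Two distinct values would put a nondegenerate interval, which has positive
    measure, inside the connected null image.\<close>
  have "\<not> f x < f y" if "x \<in> {a..b}" "y \<in> {a..b}" for x y
  proof
    assume "f x < f y"
    moreover have "{f x..f y} \<subseteq> f ` {a..b}"
      using connected_contains_Icc[OF conn] that by blast
    ultimately have "box (f x) (f y) = {}"
      using negligible_subset[OF neg] negligible_interval(1)[of "f x" "f y"]
      by (simp only: cbox_interval)
    with \<open>f x < f y\<close> show False
      by simp
  qed
  then show ?thesis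
    unfolding constant_on_def by (metis linorder_neqE)
qed

text \<open>The points of \<open>S\<close> where \<open>f\<close> differs from \<open>c\<close> form
  an open null set, and only the empty set is both.\<close>

lemma continuous_AE_eq_const_imp_eq:
  fixes f :: "'a::euclidean_space \<Rightarrow> 'b::t1_space"
  assumes "open S" and cont: "continuous_on S f"
    and ae: "AE x in lebesgue_on S. f x = c" and "x \<in> S"
  shows "f x = c"
proof -
  let ?V = "S \<inter> f -` (- {c})"
  have "open ?V"
    using assms by (intro continuous_open_preimage) auto
  moreover have "AE x in lebesgue. x \<notin> ?V"
    using ae \<open>open S\<close> by (auto simp: AE_restrict_space_iff elim!: eventually_mono)
  then have "negligible ?V"
    unfolding negligible_iff_null_sets
    using \<open>open ?V\<close> by (subst completion.null_sets_iff_AE) auto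
  ultimately have "?V = {}"
    using open_not_negligible by blast
  then show ?thesis
    using \<open>x \<in> S\<close> by auto
qed

section \<open>Regularity of the linear Hamiltonians along a curve\<close>

lemma continuous_on_lin_ham:
  assumes "continuous_on UNIV X" and "continuous_on A lam"
  shows "continuous_on A (\<lambda>t. lin_ham X (lam t))"
  unfolding lin_ham_def
  by (intro continuous_intros assms continuous_on_compose2[OF assms(1)]) auto

lemma continuous_vector_fields:
  "continuous_on UNIV X1" "continuous_on UNIV X2" "continuous_on UNIV X3"
  unfolding X1_def X2_def X3_def by (intro continuous_intros; simp)+

lemma h4_h5_eq: "h4 l = snd l $ 4" "h5 l = snd l $ 5"
  by (simp_all add: lin_ham_def X4_def X5_def inner_axis)

lemma lipschitz_on_snd_nth:
  fixes lam :: "real \<Rightarrow> covector"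
  assumes "L-lipschitz_on A lam"
  shows "L-lipschitz_on A (\<lambda>t. snd (lam t) $ i)"
proof (rule lipschitz_onI)
  fix s t assume "s \<in> A" "t \<in> A"
  have "dist (snd (lam s) $ i) (snd (lam t) $ i) \<le> dist (lam s) (lam t)"
    by (rule order_trans[OF dist_vec_nth_le dist_snd_le])
  then show "dist (snd (lam s) $ i) (snd (lam t) $ i) \<le> L * dist s t"
    using lipschitz_onD[OF assms \<open>s \<in> A\<close> \<open>t \<in> A\<close>] by linarith
qed (rule lipschitz_on_nonneg[OF assms])

section \<open>Restriction to the open arc\<close>

lemma AE_lebesgue_on_subset:
  assumes "AE x in lebesgue_on A. P x" and "B \<subseteq> A" and "A \<in> sets lebesgue" "B \<in> sets lebesgue"
  shows "AE x in lebesgue_on B. P x"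
proof -
  have "AE x in lebesgue. x \<in> A \<longrightarrow> P x"
    using assms(1,3) by (simp add: AE_restrict_space_iff)
  then have "AE x in lebesgue. x \<in> B \<longrightarrow> P x"
    by (rule eventually_mono) (use assms(2) in blast)
  then show ?thesis
    using assms(4) by (simp add: AE_restrict_space_iff)
qed

text \<open>Serves to differentiate \<open>h2 = 0\<close> and \<open>h3 = 0\<close> along the arc:
  at a point of the open set \<open>S\<close>, the derivative within \<open>A\<close> is the
  two-sided one, and \<open>f\<close> is locally zero there.\<close>

lemma deriv_zero_of_zero_on_open:
  fixes f :: "real \<Rightarrow> real"
  assumes "open S" "S \<subseteq> A" "t \<in> S" "\<And>s. s \<in> S \<Longrightarrow> f s = 0"
    and "(f has_real_derivative d) (at t within A)"
  shows "d = 0"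
proof -
  have "(f has_real_derivative d) (at t)"
    using DERIV_subset[OF assms(5,2)] by (simp only: at_within_open[OF assms(3,1)])
  moreover have "(f has_real_derivative 0) (at t)"
    by (rule has_field_derivative_transform_within_open[OF DERIV_const assms(1,3)])
       (simp add: assms(4))
  ultimately show ?thesis
    by (rule DERIV_unique)
qed

text \<open>If \<open>P\<close> failed throughout, the absurd equation \<open>0 = 1\<close> would
  hold almost everywhere on the interval, hence, both sides being continuous, at its
  midpoint.\<close>

lemma AE_lebesgue_on_interval_ex:
  fixes \<alpha> \<beta> :: real
  assumes "\<alpha> < \<beta>" and "AE t in lebesgue_on {\<alpha><..<\<beta>}. P t"
  shows "\<exists>t\<in>{\<alpha><..<\<beta>}. P t"
proof (rule ccontr)
  assume "\<not> ?thesis"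
  then have "AE t in lebesgue_on {\<alpha><..<\<beta>}. (0::real) = 1"
    using assms(2) by (rule_tac lebesgue_on_mono) auto
  from continuous_AE_eq_const_imp_eq[OF _ _ this, of "(\<alpha> + \<beta>) / 2"] assms(1)
  show False by simp
qed

theorem theorem5:
  fixes T \<alpha> \<beta> :: real
    and lam :: "real \<Rightarrow> covector"
    and u :: "real \<Rightarrow> real^2"
  assumes "h2_singular_normal_arc T lam u \<alpha> \<beta>"
  shows
    "((\<forall>t\<in>{\<alpha><..<\<beta>}. h2 (lam t) = 0 \<and> h3 (lam t) = 0 \<and> h4 (lam t) = 0 \<and> h5 (lam t) = 0) \<and>
      (\<exists>c. c \<noteq> 0 \<and> (\<forall>t\<in>{\<alpha><..<\<beta>}. h1 (lam t) = c)) \<and>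
      (\<exists>s1\<in>{1, -1}. AE t in lebesgue_on {\<alpha><..<\<beta>}. u t $ 1 = s1 \<and> \<bar>u t $ 2\<bar> \<le> 1))
     \<or>
     ((\<forall>t\<in>{\<alpha><..<\<beta>}. h2 (lam t) = 0 \<and> h3 (lam t) = 0) \<and>
      (\<exists>c. c \<noteq> 0 \<and> (\<forall>t\<in>{\<alpha><..<\<beta>}. h1 (lam t) = c)) \<and>
      (\<forall>t\<in>{\<alpha><..<\<beta>}. h5 (lam t) \<noteq> 0 \<and> \<bar>h4 (lam t) / h5 (lam t)\<bar> \<le> 1) \<and>
      (\<exists>s1\<in>{1, -1}. \<exists>u2a.
         (\<forall>t\<in>{\<alpha><..<\<beta>}. u2a = - s1 * (h4 (lam t) / h5 (lam t))) \<and>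
         (AE t in lebesgue_on {\<alpha><..<\<beta>}. u t $ 1 = s1 \<and> u t $ 2 = u2a)))"
proof -
  let ?I = "{\<alpha><..<\<beta>}"
  have ext: "normal_extremal T lam u" and ab: "\<alpha> < \<beta>" and I: "?I \<subseteq> {0..T}"
    and h2: "\<And>t. t \<in> ?I \<Longrightarrow> h2 (lam t) = 0"
    using assms by (auto simp: h2_singular_normal_arc_def)
  obtain L c where lip: "L-lipschitz_on {0..T} lam" and "c > 0"
    and H: "\<And>t. t \<in> {0..T} \<Longrightarrow> max_ham (lam t) = c"
    and U: "AE t in lebesgue_on {0..T}. u t \<in> control_set"
    and der: "AE t in lebesgue_on {0..T}.
      ((\<lambda>s. h2 (lam s)) has_real_derivative u t $ 1 * h3 (lam t)) (at t within {0..T}) \<and>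
      ((\<lambda>s. h3 (lam s)) has_real_derivative u t $ 1 * h4 (lam t) + u t $ 2 * h5 (lam t))
        (at t within {0..T})"
    and der4: "AE t in lebesgue_on {0..T}.
      ((\<lambda>s. h4 (lam s)) has_real_derivative 0) (at t within {0..T})"
    and der5: "AE t in lebesgue_on {0..T}.
      ((\<lambda>s. h5 (lam s)) has_real_derivative 0) (at t within {0..T})"
    using ext unfolding normal_extremal_def admissible_control_def eventually_conj_iff by blast
  \<comment> \<open>The two equalities of the maximum condition are chained, so the supremum never
    has to be evaluated.\<close>
  have max: "AE t in lebesgue_on {0..T}.
      u t $ 1 * h1 (lam t) + u t $ 2 * h2 (lam t) = max_ham (lam t)"
    using ext unfolding normal_extremal_def by (auto elim: eventually_mono)
  note on_I = AE_lebesgue_on_subset[OF _ I]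
  have "continuous_on ?I lam"
    using lipschitz_on_continuous_on[OF lip] I continuous_on_subset by blast
  note cont = continuous_vector_fields[THEN continuous_on_lin_ham, OF this]

  \<comment> \<open>\<open>X4\<close> and \<open>X5\<close> are constant fields, so
    \<open>h4\<close> and \<open>h5\<close> are coordinates of the covector and inherit the
    Lipschitz constant of \<open>lam\<close>.\<close>
  obtain k4 k5 where k4: "\<And>t. t \<in> {0..T} \<Longrightarrow> h4 (lam t) = k4"
    and k5: "\<And>t. t \<in> {0..T} \<Longrightarrow> h5 (lam t) = k5"
    using lipschitz_AE_deriv_zero_constant_on[OF lipschitz_on_snd_nth[OF lip, of 4]]
      lipschitz_AE_deriv_zero_constant_on[OF lipschitz_on_snd_nth[OF lip, of 5]] der4 der5
    unfolding constant_on_def h4_h5_eq by blast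

  have abs_h1: "\<bar>h1 (lam t)\<bar> = c" if "t \<in> ?I" for t
    using H[of t] I h2[OF that] that by (auto simp: max_ham_def)
  have "(\<lambda>t. h1 (lam t)) constant_on ?I"
  \<comment> \<open>Continuity on the connected arc excludes a jump between \<open>c\<close> and
    \<open>-c\<close>.\<close>
  proof (rule continuous_finite_range_constant)
    have "(\<lambda>t. h1 (lam t)) ` ?I \<subseteq> {c, -c}"
    proof (rule image_subsetI)
      show "h1 (lam t) \<in> {c, -c}" if "t \<in> ?I" for t
        using abs_h1[OF that] by (auto simp: abs_if split: if_splits)
    qed
    then show "finite ((\<lambda>t. h1 (lam t)) ` ?I)"
      by (rule finite_subset) simp
  qed (simp_all add: cont)
  then obtain d where d: "\<And>t. t \<in> ?I \<Longrightarrow> h1 (lam t) = d"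
    unfolding constant_on_def by blast
  have abs_d: "\<bar>d\<bar> = c"
    using abs_h1[of "(\<alpha> + \<beta>) / 2"] d[of "(\<alpha> + \<beta>) / 2"] ab by simp
  have "d \<noteq> 0" using abs_d \<open>c > 0\<close> by auto
  define s1 where "s1 = sgn d"
  have s1: "s1 \<in> {1, -1}"
    using \<open>d \<noteq> 0\<close> by (auto simp: s1_def sgn_if)

  have ctl: "AE t in lebesgue_on ?I. u t $ 1 = s1 \<and> \<bar>u t $ 2\<bar> \<le> 1"
  proof (rule lebesgue_on_mono)
    show "AE t in lebesgue_on ?I. u t \<in> control_set \<and>
        u t $ 1 * h1 (lam t) + u t $ 2 * h2 (lam t) = max_ham (lam t)"
      using on_I[OF U] on_I[OF max] by auto
    fix t assume t: "u t \<in> control_set \<and>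
        u t $ 1 * h1 (lam t) + u t $ 2 * h2 (lam t) = max_ham (lam t)" "t \<in> ?I"
    \<comment> \<open>As \<open>h2\<close> vanishes, the maximum condition reads
      \<open>u t $ 1 * d = c\<close>, and \<open>c\<close> is \<bar>d\<bar> =
      \<open>sgn d * d\<close>.\<close>
    then have "u t $ 1 * d = s1 * d"
      using H[of t] I h2 d abs_d by (auto simp: s1_def abs_sgn mult.commute)
    then show "u t $ 1 = s1 \<and> \<bar>u t $ 2\<bar> \<le> 1"
      using t \<open>d \<noteq> 0\<close> by (simp add: control_set_def)
  qed
  \<comment> \<open>The derivative of \<open>h2\<close> yields this only for almost every time;
    continuity of \<open>h3\<close> along the arc extends it to all times.\<close>
  have h3: "h3 (lam t) = 0" if "t \<in> ?I" for t
  proof (rule continuous_AE_eq_const_imp_eq[OF _ cont(3) _ that])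
    have "AE t in lebesgue_on ?I. u t $ 1 = s1 \<and>
        ((\<lambda>s. h2 (lam s)) has_real_derivative u t $ 1 * h3 (lam t)) (at t within {0..T})"
      using ctl on_I[OF der] by auto
    then show "AE t in lebesgue_on ?I. h3 (lam t) = 0"
    proof (rule lebesgue_on_mono)
      fix t assume t: "u t $ 1 = s1 \<and>
        ((\<lambda>s. h2 (lam s)) has_real_derivative u t $ 1 * h3 (lam t)) (at t within {0..T})" "t \<in> ?I"
      have "u t $ 1 * h3 (lam t) = 0"
        by (rule deriv_zero_of_zero_on_open[OF _ I t(2) h2 t(1)[THEN conjunct2]]) simp_all
      then show "h3 (lam t) = 0"
        using t(1) s1 by auto
    qed
  qed simp
  have rel: "AE t in lebesgue_on ?I. u t $ 1 = s1 \<and> \<bar>u t $ 2\<bar> \<le> 1 \<and> s1 * k4 + u t $ 2 * k5 = 0"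
  proof (rule lebesgue_on_mono)
    show "AE t in lebesgue_on ?I. (u t $ 1 = s1 \<and> \<bar>u t $ 2\<bar> \<le> 1) \<and>
       ((\<lambda>s. h3 (lam s)) has_real_derivative u t $ 1 * h4 (lam t) + u t $ 2 * h5 (lam t))
        (at t within {0..T})"
      using ctl on_I[OF der] by auto
    fix t assume t: "(u t $ 1 = s1 \<and> \<bar>u t $ 2\<bar> \<le> 1) \<and>
       ((\<lambda>s. h3 (lam s)) has_real_derivative u t $ 1 * h4 (lam t) + u t $ 2 * h5 (lam t))
        (at t within {0..T})" "t \<in> ?I"
    have "u t $ 1 * h4 (lam t) + u t $ 2 * h5 (lam t) = 0"
      by (rule deriv_zero_of_zero_on_open[OF _ I t(2) h3 t(1)[THEN conjunct2]]) simp_all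
    then show "u t $ 1 = s1 \<and> \<bar>u t $ 2\<bar> \<le> 1 \<and> s1 * k4 + u t $ 2 * k5 = 0"
      using t k4[of t] k5[of t] I by auto
  qed
  \<comment> \<open>Since \<open>k4\<close> and \<open>k5\<close> do not depend on time, one good
    time decides both cases: it gives \<open>k4 = 0\<close> if \<open>k5 = 0\<close>, and otherwise
    the bound on \<open>k4 / k5\<close>.\<close>
  obtain t0 where t0: "\<bar>u t0 $ 2\<bar> \<le> 1" "s1 * k4 + u t0 $ 2 * k5 = 0"
    using AE_lebesgue_on_interval_ex[OF ab rel] by auto
  have k4I: "h4 (lam t) = k4" and k5I: "h5 (lam t) = k5" if "t \<in> ?I" for t
    using k4 k5 I that by auto
  have h1_const: "\<exists>c. c \<noteq> 0 \<and> (\<forall>t\<in>?I. h1 (lam t) = c)"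
    using d \<open>d \<noteq> 0\<close> by blast
  show ?thesis
  proof (cases "k5 = 0")
    case True
    then have "k4 = 0" using t0(2) s1 by auto
    then show ?thesis
      using True s1 ctl h1_const by (simp add: h2 h3 k4I k5I) blast
  next
    case False
    have solve: "x = - s1 * (k4 / k5)" if "s1 * k4 + x * k5 = 0" for x
      using that False by (simp add: field_simps)
    \<comment> \<open>The control constraint at \<open>t0\<close> becomes the bound on the ratio
      because \<open>s1\<close> has modulus 1.\<close>
    have le: "\<bar>k4 / k5\<bar> \<le> 1"
      using t0(1) s1 unfolding solve[OF t0(2)] by auto
    have u: "AE t in lebesgue_on ?I. u t $ 1 = s1 \<and> u t $ 2 = - s1 * (k4 / k5)"
      using rel by (rule eventually_mono) (use solve in blast)
    have "\<forall>t\<in>?I. - s1 * (k4 / k5) = - s1 * (h4 (lam t) / h5 (lam t))"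
      using k4I k5I by simp
    with u s1 have "\<exists>s1\<in>{1, -1}. \<exists>u2a. (\<forall>t\<in>?I. u2a = - s1 * (h4 (lam t) / h5 (lam t))) \<and>
        (AE t in lebesgue_on ?I. u t $ 1 = s1 \<and> u t $ 2 = u2a)"
      by blast
    moreover have "\<forall>t\<in>?I. h5 (lam t) \<noteq> 0 \<and> \<bar>h4 (lam t) / h5 (lam t)\<bar> \<le> 1"
      using False le k4I k5I by simp
    moreover have "\<forall>t\<in>?I. h2 (lam t) = 0 \<and> h3 (lam t) = 0"
      using h2 h3 by simp
    ultimately show ?thesis
      using h1_const by blast
  qed
qed

end
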